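(* Let $\mathscr{I}^{\nearrow}_{\infty}(\mathbb{Z})$ be the monoid of all injective monotone partial selfmaps of $\mathbb{Z}$ with cofinite domain and cofinite range. Let $S$ be a topological semigroup which contains $\mathscr{I}^{\nearrow}_{\infty}(\mathbb{Z})$ as a dense discrete subsemigroup. If $I=S\setminus\mathscr{I}^{\nearrow}_{\infty}(\mathbb{Z})\neq\varnothing$, then $I$ is an ideal of $S$.
   Context: A partial map $\alpha\colon\mathbb{Z}\rightharpoonup\mathbb{Z}$ is monotone if $n\leqslant m$ implies $(n)\alpha\leqslant(m)\alpha$ for $n,m\in\operatorname{dom}\alpha$. $\mathscr{I}^{\nearrow}_{\infty}(\mathbb{Z})$ is the set of all injective monotone partial maps $\alpha\colon\mathbb{Z}\rightharpoonup\mathbb{Z}$ with $|\mathbb{Z}\setminus\operatorname{dom}\alpha|<\infty$ and $|\mathbb{Z}\setminus\operatorname{ran}\alpha|<\infty$, with composition $x(\alpha\beta)=(x\alpha)\beta$ for $x\in\operatorname{dom}(\alpha\beta)=\{y\in\operatorname{dom}\alpha\mid y\alpha\in\operatorname{dom}\beta\}$ (maps are written on the right). A topological semigroup is a Hausdorff topological space with a jointly continuous semigroup operation. "Contains as a dense discrete subsemigroup" means that $S$ has a subsemigroup (identified with $\mathscr{I}^{\nearrow}_{\infty}(\mathbb{Z})$ via a semigroup isomorphism) which is dense in $S$ and whose subspace topology is discrete. Ideal means two-sided ideal. *)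

theory Defs
  imports "HOL-Analysis.Analysis"
begin

(* Partial maps Z -> Z are encoded as int \<rightharpoonup> int, i.e. int \<Rightarrow> int option. *)
definition I_inf_Z :: "(int \<rightharpoonup> int) set" where
  "I_inf_Z = {\<alpha>. inj_on \<alpha> (dom \<alpha>) \<and> mono_on (dom \<alpha>) (\<lambda>n. the (\<alpha> n)) \<and>
                 finite (UNIV - dom \<alpha>) \<and> finite (UNIV - ran \<alpha>)}"

(* Maps act on the right, x (\<alpha> \<beta>) = (x \<alpha>) \<beta>, whereas map_comp applies its second argument first. *)
definition rcomp :: "(int \<rightharpoonup> int) \<Rightarrow> (int \<rightharpoonup> int) \<Rightarrow> (int \<rightharpoonup> int)" (infixl "\<cdot>\<^sub>r" 70) where
  "\<alpha> \<cdot>\<^sub>r \<beta> = \<beta> \<circ>\<^sub>m \<alpha>"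

lemma dom_rcomp: "dom (\<alpha> \<cdot>\<^sub>r \<beta>) = {y \<in> dom \<alpha>. the (\<alpha> y) \<in> dom \<beta>}"
  by (auto simp: rcomp_def map_comp_def dom_def split: option.splits)

lemma rcomp_apply: "x \<in> dom (\<alpha> \<cdot>\<^sub>r \<beta>) \<Longrightarrow> the ((\<alpha> \<cdot>\<^sub>r \<beta>) x) = the (\<beta> (the (\<alpha> x)))"
  by (auto simp: rcomp_def map_comp_def dom_def split: option.splits)

lemma rcomp_in_I_inf_Z:
  assumes a: "\<alpha> \<in> I_inf_Z" and b: "\<beta> \<in> I_inf_Z"
  shows "\<alpha> \<cdot>\<^sub>r \<beta> \<in> I_inf_Z"
proof -
  have ia: "inj_on \<alpha> (dom \<alpha>)" and ib: "inj_on \<beta> (dom \<beta>)"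
    and ma: "mono_on (dom \<alpha>) (\<lambda>n. the (\<alpha> n))" and mb: "mono_on (dom \<beta>) (\<lambda>n. the (\<beta> n))"
    and fa: "finite (UNIV - dom \<alpha>)" "finite (UNIV - ran \<alpha>)"
    and fb: "finite (UNIV - dom \<beta>)" "finite (UNIV - ran \<beta>)"
    using a b by (auto simp: I_inf_Z_def)
  have ja: "n = m" if "\<alpha> n = Some x" "\<alpha> m = Some x" for n m x
    using ia that by (metis domI inj_onD)
  have jb: "n = m" if "\<beta> n = Some x" "\<beta> m = Some x" for n m x
    using ib that by (metis domI inj_onD)
  have "inj_on (\<alpha> \<cdot>\<^sub>r \<beta>) (dom (\<alpha> \<cdot>\<^sub>r \<beta>))"
  proof (rule inj_onI)
    fix x y assume "x \<in> dom (\<alpha> \<cdot>\<^sub>r \<beta>)" "y \<in> dom (\<alpha> \<cdot>\<^sub>r \<beta>)" "(\<alpha> \<cdot>\<^sub>r \<beta>) x = (\<alpha> \<cdot>\<^sub>r \<beta>) y"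
    then obtain u v z where "\<alpha> x = Some u" "\<alpha> y = Some v" "\<beta> u = Some z" "\<beta> v = Some z"
      by (auto simp: rcomp_def map_comp_def split: option.splits)
    then show "x = y" using ja jb by metis
  qed
  moreover have "mono_on (dom (\<alpha> \<cdot>\<^sub>r \<beta>)) (\<lambda>n. the ((\<alpha> \<cdot>\<^sub>r \<beta>) n))"
  proof (rule mono_onI)
    fix r s assume rs: "r \<in> dom (\<alpha> \<cdot>\<^sub>r \<beta>)" "s \<in> dom (\<alpha> \<cdot>\<^sub>r \<beta>)" "r \<le> s"
    then have "the (\<alpha> r) \<le> the (\<alpha> s)"
      using ma by (auto simp: dom_rcomp mono_on_def)
    then have "the (\<beta> (the (\<alpha> r))) \<le> the (\<beta> (the (\<alpha> s)))"
      using mb rs by (auto simp: dom_rcomp mono_on_def)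
    then show "the ((\<alpha> \<cdot>\<^sub>r \<beta>) r) \<le> the ((\<alpha> \<cdot>\<^sub>r \<beta>) s)"
      using rs by (simp add: rcomp_apply)
  qed
  moreover have "finite (UNIV - dom (\<alpha> \<cdot>\<^sub>r \<beta>))"
  proof -
    have "finite ((\<lambda>n. the (\<alpha> n)) -` (UNIV - dom \<beta>) \<inter> dom \<alpha>)"
      by (rule finite_vimage_IntI[OF fb(1)]) (auto simp: inj_on_def dest: ja)
    then show ?thesis
      by (rule finite_subset[rotated, OF finite_UnI[OF fa(1)]]) (auto simp: dom_rcomp)
  qed
  moreover have "finite (UNIV - ran (\<alpha> \<cdot>\<^sub>r \<beta>))"
  proof -
    have "UNIV - ran (\<alpha> \<cdot>\<^sub>r \<beta>) \<subseteq> (UNIV - ran \<beta>) \<union> (\<lambda>n. the (\<beta> n)) ` (UNIV - ran \<alpha>)"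
    proof
      fix z assume z: "z \<in> UNIV - ran (\<alpha> \<cdot>\<^sub>r \<beta>)"
      show "z \<in> (UNIV - ran \<beta>) \<union> (\<lambda>n. the (\<beta> n)) ` (UNIV - ran \<alpha>)"
      proof (cases "z \<in> ran \<beta>")
        case True
        then obtain y where y: "\<beta> y = Some z" by (auto simp: ran_def)
        have "y \<notin> ran \<alpha>"
        proof
          assume "y \<in> ran \<alpha>"
          then obtain x where "\<alpha> x = Some y" by (auto simp: ran_def)
          with y have "(\<alpha> \<cdot>\<^sub>r \<beta>) x = Some z" by (simp add: rcomp_def)
          with z show False by (auto simp: ran_def)
        qed
        then show ?thesis using y by force
      qed simp
    qed
    then show ?thesis by (rule finite_subset) (use fa fb in auto)
  qed
  ultimately show ?thesis by (simp add: I_inf_Z_def)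
qed

definition subsemigroup :: "'a::semigroup_mult set \<Rightarrow> bool" where
  "subsemigroup T \<longleftrightarrow> T \<noteq> {} \<and> (\<forall>x\<in>T. \<forall>y\<in>T. x * y \<in> T)"

definition semigroup_ideal :: "'a::semigroup_mult set \<Rightarrow> bool" where
  "semigroup_ideal J \<longleftrightarrow> J \<noteq> {} \<and> (\<forall>x\<in>J. \<forall>s. s * x \<in> J \<and> x * s \<in> J)"

end

theory Submission
  imports Defs
begin

text \<open>
  Being dense and discrete, \<open>T\<close> consists of isolated points of the whole semigroup. If \<open>s * x = b \<in> T\<close>
  with \<open>x \<notin> T\<close>, then \<open>b\<close> being isolated gives neighbourhoods \<open>U\<close> of \<open>s\<close> and \<open>V\<close> of \<open>x\<close> with \<open>U * V = {b}\<close>.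
  Any \<open>u \<in> U \<inter> T\<close> satisfies \<open>u * v = b\<close> for all of the infinitely many \<open>v \<in> V \<inter> T\<close>. This is impossible
  since in the monoid of cofinite partial injections each equation \<open>\<alpha> \<xi> = \<beta>\<close> or \<open>\<xi> \<alpha> = \<beta>\<close> has only
  finitely many solutions \<open>\<xi>\<close>: the solution is prescribed off a finite set, and on that set it takes
  values in a finite set.
\<close>

text \<open>Discreteness gives an open \<open>U\<close> meeting \<open>T\<close> only in
  \<open>b\<close>. In a T1 space \<open>U - {b}\<close> is again open, and since it misses the
  dense set \<open>T\<close> it is empty.\<close>

lemma open_singleton_if_dense_discrete:
  fixes T :: "'a::t1_space set"
  assumes "closure T = UNIV" "discrete T" "b \<in> T"
  shows "open {b}"
proof -
  obtain U where U: "open U" "U \<inter> T = {b}"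
    using assms by (auto simp: discrete_def isolated_in_def)
  have "open (U - {b})" using U(1) by (simp add: open_Diff)
  moreover have "(U - {b}) \<inter> T = {}" using U by blast
  ultimately have "U - {b} = {}"
    using assms(1) open_Int_closure_eq_empty[of "U - {b}" T] by simp
  then have "U = {b}" using U by blast
  then show ?thesis using U by simp
qed

text \<open>Joint continuity in neighbourhood form, unpacked from the filter statement
  \<open>tendsto_mult_Pair\<close>.\<close>

lemma open_nhds_mult:
  fixes x y :: "'a::topological_semigroup_mult"
  assumes "open W" "x * y \<in> W"
  obtains U V where "open U" "open V" "x \<in> U" "y \<in> V" "\<forall>u\<in>U. \<forall>v\<in>V. u * v \<in> W"
proof -
  have "\<forall>\<^sub>F p in nhds x \<times>\<^sub>F nhds y. fst p * snd p \<in> W"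
    using topological_tendstoD[OF tendsto_mult_Pair assms] by simp
  then obtain P Q where PQ: "eventually P (nhds x)" "eventually Q (nhds y)"
      "\<And>u v. P u \<Longrightarrow> Q v \<Longrightarrow> u * v \<in> W"
    by (auto simp: eventually_prod_filter)
  obtain U where U: "open U" "x \<in> U" "\<forall>u\<in>U. P u"
    using PQ(1) by (auto simp: eventually_nhds)
  obtain V where V: "open V" "y \<in> V" "\<forall>v\<in>V. Q v"
    using PQ(2) by (auto simp: eventually_nhds)
  show thesis
    by (rule that[OF U(1) V(1) U(2) V(2)]) (use U V PQ(3) in blast)
qed

text \<open>Finite sets are closed in a T1 space, so \<open>V - F\<close> is still an open
  neighbourhood of \<open>x\<close>. With \<open>F\<close> empty this merely picks a point of
  \<open>T\<close> in \<open>V\<close>.\<close>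

lemma dense_meets_open_minus_finite:
  fixes T :: "'a::t1_space set"
  assumes "closure T = UNIV" "open V" "x \<in> V" "x \<notin> F" "finite F"
  obtains v where "v \<in> T" "v \<in> V" "v \<notin> F"
proof -
  have "open (V - F)" using assms by (simp add: open_Diff finite_imp_closed)
  moreover have "x \<in> V - F" using assms by simp
  ultimately have "(V - F) \<inter> T \<noteq> {}"
    using assms(1) open_Int_closure_eq_empty[of "V - F" T] by auto
  then show thesis using that by blast
qed

lemma semigroup_ideal_compl_dense_discrete:
  fixes T :: "'s::{t2_space, topological_semigroup_mult} set"
  assumes dense: "closure T = UNIV" and discr: "discrete T" and ne: "UNIV - T \<noteq> {}"
    and fin_left: "\<And>a b. a \<in> T \<Longrightarrow> b \<in> T \<Longrightarrow> finite {x \<in> T. a * x = b}"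
    and fin_right: "\<And>a b. a \<in> T \<Longrightarrow> b \<in> T \<Longrightarrow> finite {x \<in> T. x * a = b}"
  shows "semigroup_ideal (UNIV - T)"
proof -
  have "s * x \<notin> T" if x: "x \<notin> T" for s x
  proof
    assume b: "s * x \<in> T"
    obtain U V where UV: "open U" "open V" "s \<in> U" "x \<in> V"
      and mult: "\<forall>u\<in>U. \<forall>v\<in>V. u * v \<in> {s * x}"
      by (rule open_nhds_mult[OF open_singleton_if_dense_discrete[OF dense discr b] singletonI])
    obtain u where u: "u \<in> T" "u \<in> U"
      by (rule dense_meets_open_minus_finite[OF dense UV(1,3), of "{}"]) auto
    \<comment> \<open>The removed solution set lies in \<open>T\<close>, hence does not contain
      \<open>x\<close>. The point \<open>v\<close> found near \<open>x\<close> is then a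
      non-solution, against \<open>mult\<close>.\<close>
    obtain v where "v \<in> T" "v \<in> V" "v \<notin> {y \<in> T. u * y = s * x}"
      by (rule dense_meets_open_minus_finite[OF dense UV(2,4) _ fin_left[OF u(1) b]]) (use x in auto)
    then show False using mult u by blast
  qed
  moreover have "x * s \<notin> T" if x: "x \<notin> T" for s x
  proof
    assume b: "x * s \<in> T"
    obtain U V where UV: "open U" "open V" "x \<in> U" "s \<in> V"
      and mult: "\<forall>u\<in>U. \<forall>v\<in>V. u * v \<in> {x * s}"
      by (rule open_nhds_mult[OF open_singleton_if_dense_discrete[OF dense discr b] singletonI])
    obtain v where v: "v \<in> T" "v \<in> V"
      by (rule dense_meets_open_minus_finite[OF dense UV(2,4), of "{}"]) auto
    obtain u where "u \<in> T" "u \<in> U" "u \<notin> {y \<in> T. y * v = x * s}"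
      by (rule dense_meets_open_minus_finite[OF dense UV(1,3) _ fin_right[OF v(1) b]]) (use x in auto)
    then show False using mult v by blast
  qed
  ultimately show ?thesis using ne by (simp add: semigroup_ideal_def)
qed

text \<open>Pasting with \<open>g\<close> outside \<open>F\<close> reduces this to
  \<open>finite_set_of_finite_funs\<close>, which expects a constant default there;
  \<open>undefined\<close> serves as that default.\<close>

lemma finite_funs_prescribed_off:
  assumes "finite F" "finite B"
  shows "finite {f. (\<forall>x\<in>F. f x \<in> B) \<and> (\<forall>x. x \<notin> F \<longrightarrow> f x = g x)}"
proof (rule finite_subset)
  let ?H = "{h. \<forall>x. (x \<in> F \<longrightarrow> h x \<in> B) \<and> (x \<notin> F \<longrightarrow> h x = undefined)}"
  show "finite ((\<lambda>h x. if x \<in> F then h x else g x) ` ?H)"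
    using finite_set_of_finite_funs[OF assms] by simp
  show "{f. (\<forall>x\<in>F. f x \<in> B) \<and> (\<forall>x. x \<notin> F \<longrightarrow> f x = g x)}
      \<subseteq> (\<lambda>h x. if x \<in> F then h x else g x) ` ?H"
  proof
    fix f assume f: "f \<in> {f. (\<forall>x\<in>F. f x \<in> B) \<and> (\<forall>x. x \<notin> F \<longrightarrow> f x = g x)}"
    then have "f = (\<lambda>x. if x \<in> F then (if x \<in> F then f x else undefined) else g x)" by auto
    moreover have "(\<lambda>x. if x \<in> F then f x else undefined) \<in> ?H" using f by auto
    ultimately show "f \<in> (\<lambda>h x. if x \<in> F then h x else g x) ` ?H" by (rule image_eqI)
  qed
qed

lemma I_inf_Z_inj: "\<alpha> \<in> I_inf_Z \<Longrightarrow> \<alpha> x = Some z \<Longrightarrow> \<alpha> y = Some z \<Longrightarrow> x = y"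
  by (metis (mono_tags, lifting) I_inf_Z_def domI inj_onD mem_Collect_eq)

text \<open>On the cofinite set \<open>ran \<alpha>\<close> the equation forces the values of
  \<open>\<xi>\<close>. These values already exhaust \<open>ran \<beta>\<close>, so by injectivity
  \<open>\<xi>\<close> is undefined or lands outside \<open>ran \<beta>\<close> at the finitely many
  other points.\<close>

lemma finite_solutions_left:
  assumes a: "\<alpha> \<in> I_inf_Z" and b: "\<beta> \<in> I_inf_Z"
  shows "finite {\<xi> \<in> I_inf_Z. \<alpha> \<cdot>\<^sub>r \<xi> = \<beta>}" (is "finite ?X")
proof (cases "?X = {}")
  case False
  \<comment> \<open>Any one solution can serve as the reference map with which all solutions agree
    on \<open>ran \<alpha>\<close>.\<close>
  then obtain \<xi>\<^sub>0 where c0: "\<alpha> \<cdot>\<^sub>r \<xi>\<^sub>0 = \<beta>" by blast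
  let ?B = "insert None (Some ` (UNIV - ran \<beta>))"
  have "?X \<subseteq> {\<xi>. (\<forall>y\<in>UNIV - ran \<alpha>. \<xi> y \<in> ?B) \<and> (\<forall>y. y \<notin> UNIV - ran \<alpha> \<longrightarrow> \<xi> y = \<xi>\<^sub>0 y)}"
  proof (intro subsetI CollectI conjI ballI allI impI)
    fix \<xi> y assume "\<xi> \<in> ?X" and y: "y \<in> UNIV - ran \<alpha>"
    then have c: "\<xi> \<in> I_inf_Z" "\<alpha> \<cdot>\<^sub>r \<xi> = \<beta>" by auto
    show "\<xi> y \<in> ?B"
    proof (cases "\<xi> y")
      case (Some z)
      have "z \<notin> ran \<beta>"
      proof
        assume "z \<in> ran \<beta>"
        then obtain x where "(\<alpha> \<cdot>\<^sub>r \<xi>) x = Some z" unfolding c(2) ran_def by blast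
        then obtain y' where y': "\<alpha> x = Some y'" "\<xi> y' = Some z"
          by (auto simp: rcomp_def map_comp_def split: option.splits)
        then have "y = y'" using I_inf_Z_inj[OF c(1) Some] by blast
        then show False using y y'(1) by (simp add: ranI)
      qed
      then show ?thesis using Some by simp
    qed simp
  next
    fix \<xi> y assume "\<xi> \<in> ?X" "y \<notin> UNIV - ran \<alpha>"
    then obtain x where x: "\<alpha> x = Some y" and c: "\<alpha> \<cdot>\<^sub>r \<xi> = \<alpha> \<cdot>\<^sub>r \<xi>\<^sub>0"
      unfolding c0 ran_def by blast
    show "\<xi> y = \<xi>\<^sub>0 y" using fun_cong[OF c, of x] x by (simp add: rcomp_def)
  qed
  then show ?thesis
    by (rule finite_subset) (rule finite_funs_prescribed_off, use a b in \<open>simp_all add: I_inf_Z_def\<close>)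
next
  case True
  then show ?thesis by (simp only: finite.emptyI)
qed

text \<open>At a point \<open>x\<close> of \<open>dom \<beta>\<close> the value of
  \<open>\<xi>\<close> must be the unique preimage of \<open>\<beta> x\<close> under the injective
  \<open>\<alpha>\<close>. At the finitely many other points \<open>\<xi>\<close> is undefined or
  lands outside the cofinite set \<open>dom \<alpha>\<close>.\<close>

lemma finite_solutions_right:
  assumes a: "\<alpha> \<in> I_inf_Z" and b: "\<beta> \<in> I_inf_Z"
  shows "finite {\<xi> \<in> I_inf_Z. \<xi> \<cdot>\<^sub>r \<alpha> = \<beta>}" (is "finite ?X")
proof (cases "?X = {}")
  case False
  then obtain \<xi>\<^sub>0 where c0: "\<xi>\<^sub>0 \<cdot>\<^sub>r \<alpha> = \<beta>" by blast
  let ?B = "insert None (Some ` (UNIV - dom \<alpha>))"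
  have "?X \<subseteq> {\<xi>. (\<forall>x\<in>UNIV - dom \<beta>. \<xi> x \<in> ?B) \<and> (\<forall>x. x \<notin> UNIV - dom \<beta> \<longrightarrow> \<xi> x = \<xi>\<^sub>0 x)}"
  proof (intro subsetI CollectI conjI ballI allI impI)
    fix \<xi> x assume "\<xi> \<in> ?X" and "x \<in> UNIV - dom \<beta>"
    then have "(\<xi> \<cdot>\<^sub>r \<alpha>) x = None" by auto
    then show "\<xi> x \<in> ?B" by (cases "\<xi> x") (simp_all add: rcomp_def domIff)
  next
    fix \<xi> x assume "\<xi> \<in> ?X" "x \<notin> UNIV - dom \<beta>"
    then obtain z where z: "(\<xi> \<cdot>\<^sub>r \<alpha>) x = Some z" and z0: "(\<xi>\<^sub>0 \<cdot>\<^sub>r \<alpha>) x = Some z"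
      unfolding c0 by blast
    obtain y where y: "\<xi> x = Some y" "\<alpha> y = Some z"
      using z by (auto simp: rcomp_def map_comp_def split: option.splits)
    obtain y0 where "\<xi>\<^sub>0 x = Some y0" "\<alpha> y0 = Some z"
      using z0 by (auto simp: rcomp_def map_comp_def split: option.splits)
    then show "\<xi> x = \<xi>\<^sub>0 x" using y I_inf_Z_inj[OF a] by simp
  qed
  then show ?thesis
    by (rule finite_subset) (rule finite_funs_prescribed_off, use a b in \<open>simp_all add: I_inf_Z_def\<close>)
next
  case True
  then show ?thesis by (simp only: finite.emptyI)
qed

theorem theorem4p6:
  fixes T :: "'s::{t2_space, topological_semigroup_mult} set"
    and \<phi> :: "(int \<rightharpoonup> int) \<Rightarrow> 's"
  assumes "subsemigroup T"
    and "bij_betw \<phi> I_inf_Z T"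
    and "\<And>\<alpha> \<beta>. \<alpha> \<in> I_inf_Z \<Longrightarrow> \<beta> \<in> I_inf_Z \<Longrightarrow> \<phi> (\<alpha> \<cdot>\<^sub>r \<beta>) = \<phi> \<alpha> * \<phi> \<beta>"
    and "closure T = UNIV"
    and "discrete T"
    and "UNIV - T \<noteq> {}"
  shows "semigroup_ideal (UNIV - T)"
proof (rule semigroup_ideal_compl_dense_discrete[OF assms(4-6)])
  have img: "T = \<phi> ` I_inf_Z" and inj: "inj_on \<phi> I_inf_Z"
    using assms(2) by (auto simp: bij_betw_def)
  fix a b assume "a \<in> T" "b \<in> T"
  then obtain \<alpha> \<beta> where \<alpha>: "\<alpha> \<in> I_inf_Z" "a = \<phi> \<alpha>" and \<beta>: "\<beta> \<in> I_inf_Z" "b = \<phi> \<beta>"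
    using img by blast
  \<comment> \<open>The homomorphism property turns the equation into an equality of two
    \<open>\<phi>\<close>-values. Cancelling \<open>\<phi>\<close>, which is injective on
    \<open>I_inf_Z\<close>, uses that the composite lies in \<open>I_inf_Z\<close>.\<close>
  have "{x \<in> T. a * x = b} \<subseteq> \<phi> ` {\<xi> \<in> I_inf_Z. \<alpha> \<cdot>\<^sub>r \<xi> = \<beta>}"
    using \<alpha> \<beta> by (auto simp: img assms(3)[symmetric] rcomp_in_I_inf_Z inj_on_eq_iff[OF inj])
  then show "finite {x \<in> T. a * x = b}"
    using finite_solutions_left[OF \<alpha>(1) \<beta>(1)] by (meson finite_imageI finite_subset)
  have "{x \<in> T. x * a = b} \<subseteq> \<phi> ` {\<xi> \<in> I_inf_Z. \<xi> \<cdot>\<^sub>r \<alpha> = \<beta>}"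
    using \<alpha> \<beta> by (auto simp: img assms(3)[symmetric] rcomp_in_I_inf_Z inj_on_eq_iff[OF inj])
  then show "finite {x \<in> T. x * a = b}"
    using finite_solutions_right[OF \<alpha>(1) \<beta>(1)] by (meson finite_imageI finite_subset)
qed

end
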